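(* Let $f,g,h,h_1,\dots,h_n:M\to K$ be functions satisfying $$f(xy)=g(x)h(y)+\sum_{j=1}^{n}g_j(x)h_j(y)\qquad\text{for all }x,y\in M, \qquad( * )$$ with $f\neq0$. If the set $\{g,\mu_1,\mu_2,\dots,\mu_m\}$ is linearly independent over $K$, then there exist a nonzero multiplicative function $\chi:M\to K$ with $\chi\neq\mu_i$ for all $i\in\{1,\dots,m\}$, constants $a,b\in K^{*}$, and constants $c_1,\dots,c_n\in K$ such that $$f=ab\chi,\qquad g=b\chi-\sum_{k=1}^{n}c_kg_k,\qquad h=a\chi,\qquad h_j=ac_j\chi\ \text{ for }j=1,\dots,n.$$ Conversely, for any such $\chi$, $a,b$ and $c_1,\dots,c_n$, these formulas define a solution $(f,g,h,h_1,\dots,h_n)$ of equation $( * )$.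
   Context: $M$ is a monoid (a semigroup with neutral element $e$, not necessarily commutative), $K$ is a field, and $K^{*}=K\setminus\{0\}$. A multiplicative function is a map $\mu:M\to K$ with $\mu(xy)=\mu(x)\mu(y)$ for all $x,y\in M$; "nonzero" means not identically zero. Let $n\geq2$ be an integer. Let $\mu_1,\dots,\mu_m:M\to K$ be distinct nonzero multiplicative functions, and let $b_1,\dots,b_m\in K$ all be nonzero. The index set $\{1,\dots,m\}$ is partitioned into $n$ consecutive intervals $\{n_j,\dots,m_j\}$, $j=1,\dots,n$, with $n_1=1$, $m_j=n_{j+1}-1$ for $1\leq j\leq n-1$, $m_n=m$, and $m_j-n_j\geq1$ for every $j$ (each interval has at least two elements). For $j=1,\dots,n$ define $g_j=\sum_{i=n_j}^{m_j}b_i\mu_i$. Linear independence of a set of functions listed as $\{g,\mu_1,\dots,\mu_m\}$ means linear independence of the family $(g,\mu_1,\dots,\mu_m)$ in the $K$-vector space of functions $M\to K$. *)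

theory Defs
  imports Complex_Main "HOL-Library.Function_Algebras"
begin

definition multiplicative :: "('m::monoid_mult \<Rightarrow> 'k::field) \<Rightarrow> bool" where
  "multiplicative \<mu> \<longleftrightarrow> (\<forall>x y. \<mu> (x * y) = \<mu> x * \<mu> y)"

definition nonzero_multiplicative :: "('m::monoid_mult \<Rightarrow> 'k::field) \<Rightarrow> bool" where
  "nonzero_multiplicative \<mu> \<longleftrightarrow> multiplicative \<mu> \<and> \<mu> \<noteq> (\<lambda>x. 0)"

global_interpretation fun_space: vector_space "\<lambda>(c::'k::field) (f::'m \<Rightarrow> 'k) x. c * f x"
  by unfold_locales (auto simp: fun_eq_iff algebra_simps)

text \<open>The library's independence is a property of sets; a family is independent iff it has no
  repeated members and the set of its members is independent.\<close>

definition independent_family :: "'i set \<Rightarrow> ('i \<Rightarrow> 'm \<Rightarrow> 'k::field) \<Rightarrow> bool" where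
  "independent_family I v \<longleftrightarrow> inj_on v I \<and> fun_space.independent (v ` I)"

lemma independent_family_iff:
  fixes v :: "'i \<Rightarrow> 'm \<Rightarrow> 'k::field"
  assumes fin: "finite I"
  shows "independent_family I v \<longleftrightarrow>
    (\<forall>c. (\<forall>x. (\<Sum>i\<in>I. c i * v i x) = 0) \<longrightarrow> (\<forall>i\<in>I. c i = 0))" (is "?L \<longleftrightarrow> ?R")
proof -
  have sum_app: "(\<Sum>w\<in>A. F w) x = (\<Sum>w\<in>A. F w x)" for A and F :: "'j \<Rightarrow> 'm \<Rightarrow> 'k" and x
    by (induction A rule: infinite_finite_induct) auto
  have ind: "fun_space.independent (v ` I) \<longleftrightarrow>
      (\<forall>u. (\<forall>x. (\<Sum>w\<in>v ` I. u w * w x) = 0) \<longrightarrow> (\<forall>w\<in>v ` I. u w = 0))"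
    using fin by (auto simp: fun_space.dependent_finite fun_eq_iff sum_app)
  show ?thesis
  proof
    assume L: ?L
    then have inj: "inj_on v I" by (simp add: independent_family_def)
    show ?R
    proof (intro allI impI)
      fix c assume c: "\<forall>x. (\<Sum>i\<in>I. c i * v i x) = 0"
      let ?u = "c \<circ> inv_into I v"
      have "(\<Sum>w\<in>v ` I. ?u w * w x) = (\<Sum>i\<in>I. c i * v i x)" for x
        using inj by (simp add: sum.reindex)
      then have "\<forall>w\<in>v ` I. ?u w = 0"
        using L c ind[THEN iffD1, rule_format, of ?u] unfolding independent_family_def by auto
      then show "\<forall>i\<in>I. c i = 0" using inj by simp
    qed
  next
    assume R: ?R
    have inj: "inj_on v I"
    proof (rule inj_onI, rule ccontr)
      fix i j assume ij: "i \<in> I" "j \<in> I" "v i = v j" "i \<noteq> j"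
      let ?c = "\<lambda>k. (if k = i then 1 else 0) - (if k = j then 1 else 0) :: 'k"
      have "(\<Sum>k\<in>I. ?c k * v k x) = 0" for x
      proof -
        have "(\<Sum>k\<in>I. ?c k * v k x) =
            (\<Sum>k\<in>I. (if k = i then v k x else 0) - (if k = j then v k x else 0))"
          by (intro sum.cong) auto
        also have "\<dots> = 0" using ij fin by (simp add: sum_subtractf)
        finally show ?thesis .
      qed
      then have "?c i = 0" using R[THEN spec, of ?c] ij(1) by blast
      then show False using ij by simp
    qed
    moreover have "fun_space.independent (v ` I)"
      unfolding ind
    proof (intro allI impI)
      fix u assume "\<forall>x. (\<Sum>w\<in>v ` I. u w * w x) = 0"
      then have "\<forall>x. (\<Sum>i\<in>I. u (v i) * v i x) = 0"
        using inj by (simp add: sum.reindex)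
      then show "\<forall>w\<in>v ` I. u w = 0" using R[rule_format, of "\<lambda>i. u (v i)"] by blast
    qed
    ultimately show ?L by (simp add: independent_family_def)
  qed
qed

end

theory Submission imports Defs begin

text \<open>
  Because the members of the block of \<open>G j\<close> are multiplicative, \<open>G j (x * y)\<close> is the combination
  of the \<open>\<mu> i x\<close> with coefficients \<open>\<beta> i * \<mu> i y\<close>. Expanding \<open>f (x * y * z)\<close> in its two
  bracketings therefore gives two expressions, as functions of \<open>x\<close>, in the span of \<open>f\<close> (or \<open>g\<close>)
  and the \<open>\<mu> i\<close>, and linear independence allows their coefficients to be compared.

  Two observations carry the argument. A function of \<open>y\<close> that equals \<open>\<mu> i y * t\<close> for every \<open>i\<close>
  in a block forces \<open>t = 0\<close>, since a block contains two distinct \<open>\<mu> i\<close> (lemma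
  \<open>common_multiple_in_block_vanishes\<close>). Moreover \<open>h 1 \<noteq> 0\<close>, since otherwise \<open>f\<close> would lie in the
  span of the \<open>G j\<close> and the first observation would make \<open>f\<close> vanish (lemma
  \<open>coefficient_at_one_nonzero\<close>). Putting \<open>y = 1\<close> then expresses \<open>g\<close> through \<open>f\<close> and the \<open>G j\<close>,
  and the equation takes the normal form \<open>f (x * y) = f x * \<phi> y + (\<Sum>j. G j x * k j y)\<close> with
  \<open>\<phi> = h / h 1\<close>. Comparing the two bracketings shows that \<open>\<phi>\<close> is multiplicative and every \<open>k j\<close>
  is zero (lemma \<open>normal_form_collapses\<close>). So \<open>f\<close> is a multiple of \<open>\<phi>\<close>, and the remaining formulas
  are read off, with \<open>\<chi> = \<phi>\<close>, \<open>a = h 1\<close>, \<open>b = f 1 / h 1\<close> and \<open>c j = hs j 1 / h 1\<close>.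

  In the converse direction, the terms \<open>a * c j * G j x * \<chi> y\<close> contributed by \<open>g x * h y\<close> and by
  \<open>G j x * hs j y\<close> cancel, which leaves \<open>a * b * \<chi> x * \<chi> y\<close>.
\<close>

section \<open>Blocks of multiplicative functions\<close>

text \<open>The blocks are the fibres of a map \<open>p\<close> from the indices to the block labels. With this encoding
  a sum over blocks of sums over a block is a single sum over all indices.\<close>

locale multiplicative_blocks =
  fixes I :: "'i set" and J :: "'j set" and p :: "'i \<Rightarrow> 'j"
    and \<mu> :: "'i \<Rightarrow> 'm::monoid_mult \<Rightarrow> 'k::field"
    and \<beta> :: "'i \<Rightarrow> 'k" and G :: "'j \<Rightarrow> 'm \<Rightarrow> 'k"
  assumes finite_I: "finite I" and finite_J: "finite J" and p_into: "p ` I \<subseteq> J"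
    and mult: "\<And>i. i \<in> I \<Longrightarrow> multiplicative (\<mu> i)"
    and nz: "\<And>i. i \<in> I \<Longrightarrow> \<beta> i \<noteq> 0"
    and two: "\<And>j. j \<in> J \<Longrightarrow> \<exists>i\<in>I. \<exists>i'\<in>I. p i = j \<and> p i' = j \<and> \<mu> i \<noteq> \<mu> i'"
    and G: "\<And>j. j \<in> J \<Longrightarrow> G j = (\<lambda>x. \<Sum>i\<in>{i\<in>I. p i = j}. \<beta> i * \<mu> i x)"
begin

definition independent_with :: "('m \<Rightarrow> 'k) \<Rightarrow> bool" where
  "independent_with g \<longleftrightarrow>
    (\<forall>s r. (\<forall>x. s * g x + (\<Sum>i\<in>I. r i * \<mu> i x) = 0) \<longrightarrow> s = 0 \<and> (\<forall>i\<in>I. r i = 0))"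

lemma compare_coefficients:
  assumes "independent_with g"
    and "\<And>x. s * g x + (\<Sum>i\<in>I. r i * \<mu> i x) = s' * g x + (\<Sum>i\<in>I. r' i * \<mu> i x)"
  shows "s = s'" and "\<And>i. i \<in> I \<Longrightarrow> r i = r' i"
proof -
  have "(s - s') * g x + (\<Sum>i\<in>I. (r i - r' i) * \<mu> i x) = 0" for x
    using assms(2)[of x] by (simp add: left_diff_distrib sum_subtractf algebra_simps)
  then have "s - s' = 0 \<and> (\<forall>i\<in>I. r i - r' i = 0)"
    using assms(1)[unfolded independent_with_def, THEN spec, THEN spec,
        of "s - s'" "\<lambda>i. r i - r' i"] by blast
  then show "s = s'" and "\<And>i. i \<in> I \<Longrightarrow> r i = r' i" by auto
qed

lemma block_combination:
  "(\<Sum>j\<in>J. G j x * t j) = (\<Sum>i\<in>I. (\<beta> i * t (p i)) * \<mu> i x)"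
proof -
  have "(\<Sum>j\<in>J. G j x * t j) = (\<Sum>j\<in>J. \<Sum>i\<in>{i\<in>I. p i = j}. (\<beta> i * t (p i)) * \<mu> i x)"
    by (intro sum.cong refl) (auto simp: G sum_distrib_right intro!: sum.cong)
  also have "\<dots> = (\<Sum>i\<in>I. (\<beta> i * t (p i)) * \<mu> i x)"
    by (rule sum.group[OF finite_I finite_J p_into])
  finally show ?thesis .
qed

lemma block_combination_mult:
  "(\<Sum>j\<in>J. G j (x * y) * t j) = (\<Sum>i\<in>I. (\<beta> i * \<mu> i y * t (p i)) * \<mu> i x)"
  unfolding block_combination
  using mult by (intro sum.cong) (auto simp: multiplicative_def)

text \<open>Subtracting the hypotheses for two distinct members of the block leaves a nonzero multiple
  of \<open>t\<close> at a point where these members differ.\<close>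

lemma common_multiple_in_block_vanishes:
  assumes "j \<in> J" and "\<And>i y. i \<in> I \<Longrightarrow> p i = j \<Longrightarrow> v y = \<mu> i y * t"
  shows "t = 0"
proof (rule ccontr)
  assume t: "t \<noteq> 0"
  obtain i i' where i: "i \<in> I" "i' \<in> I" "p i = j" "p i' = j" "\<mu> i \<noteq> \<mu> i'"
    using two[OF assms(1)] by blast
  have "\<mu> i y * t = \<mu> i' y * t" for y using assms(2) i by metis
  then show False using t i(5) by (auto simp: fun_eq_iff)
qed

section \<open>The functional equation over blocks\<close>

text \<open>If \<open>h 1 = 0\<close>, then \<open>y = 1\<close> gives \<open>f = (\<Sum>j. hs j 1 * G j)\<close>. Comparing coefficients in the
  resulting two expressions for \<open>f (x * y)\<close> yields \<open>hs j y = \<mu> i y * hs j 1\<close> for each \<open>i\<close> in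
  block \<open>j\<close>. Hence all \<open>hs j 1\<close> vanish, and \<open>f\<close> with them.\<close>

lemma coefficient_at_one_nonzero:
  assumes eq: "\<And>x y. f (x * y) = g x * h y + (\<Sum>j\<in>J. G j x * hs j y)"
    and f: "f \<noteq> (\<lambda>x. 0)" and ind: "independent_with g"
  shows "h 1 \<noteq> 0"
proof
  assume h1: "h 1 = 0"
  have f_eq: "f x = (\<Sum>j\<in>J. G j x * hs j 1)" for x
    using eq[of x 1] h1 by simp
  have "h y * g x + (\<Sum>i\<in>I. (\<beta> i * hs (p i) y) * \<mu> i x)
      = 0 * g x + (\<Sum>i\<in>I. (\<beta> i * \<mu> i y * hs (p i) 1) * \<mu> i x)" for x y
    using eq[of x y] f_eq[of "x * y"] block_combination[of x "\<lambda>j. hs j y"]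
      block_combination_mult[of x y "\<lambda>j. hs j 1"] by (simp add: mult.commute)
  note coeffs = compare_coefficients(2)[OF ind this]
  have hs: "hs (p i) y = \<mu> i y * hs (p i) 1" if "i \<in> I" for i y
    using coeffs[OF that, of y] nz[OF that] by (simp add: mult.assoc)
  have "hs j 1 = 0" if "j \<in> J" for j
    using that hs by (intro common_multiple_in_block_vanishes[of j "hs j"]) blast+
  then show False using f f_eq by (auto simp: fun_eq_iff)
qed

text \<open>As functions of \<open>x\<close>, both bracketings of \<open>f (x * y * z)\<close> are combinations of \<open>f\<close> and the
  \<open>\<mu> i\<close>. The coefficients of \<open>f\<close> show that \<open>\<phi>\<close> is multiplicative. Those of \<open>\<mu> i\<close> give
  \<open>k j (y * z) - k j y * \<phi> z = \<mu> i y * k j z\<close> for each \<open>i\<close> in block \<open>j\<close>, where the left side does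
  not depend on \<open>i\<close>.\<close>

lemma normal_form_collapses:
  assumes eq: "\<And>x y. f (x * y) = f x * \<phi> y + (\<Sum>j\<in>J. G j x * k j y)"
    and ind: "independent_with f"
  shows "multiplicative \<phi>" and "\<And>j z. j \<in> J \<Longrightarrow> k j z = 0"
proof -
  have bracketings: "\<phi> (y * z) * f x + (\<Sum>i\<in>I. (\<beta> i * k (p i) (y * z)) * \<mu> i x)
      = (\<phi> y * \<phi> z) * f x
        + (\<Sum>i\<in>I. (\<beta> i * k (p i) y * \<phi> z + \<beta> i * \<mu> i y * k (p i) z) * \<mu> i x)" for x y z
  proof -
    have "\<phi> (y * z) * f x + (\<Sum>i\<in>I. (\<beta> i * k (p i) (y * z)) * \<mu> i x) = f (x * (y * z))"
      using eq[of x "y * z"] by (simp add: block_combination mult.commute)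
    also have "\<dots> = f (x * y * z)" by (simp add: mult.assoc)
    also have "\<dots> = (f x * \<phi> y + (\<Sum>i\<in>I. (\<beta> i * k (p i) y) * \<mu> i x)) * \<phi> z
        + (\<Sum>i\<in>I. (\<beta> i * \<mu> i y * k (p i) z) * \<mu> i x)"
      unfolding eq[of "x * y" z] block_combination_mult eq[of x y] block_combination ..
    also have "\<dots> = (\<phi> y * \<phi> z) * f x
        + (\<Sum>i\<in>I. (\<beta> i * k (p i) y * \<phi> z + \<beta> i * \<mu> i y * k (p i) z) * \<mu> i x)"
      by (simp add: algebra_simps sum_distrib_left sum_distrib_right sum.distrib)
    finally show ?thesis .
  qed
  show "multiplicative \<phi>"
    unfolding multiplicative_def using compare_coefficients(1)[OF ind bracketings] by blast
  have k: "k (p i) (y * z) - k (p i) y * \<phi> z = \<mu> i y * k (p i) z" if i: "i \<in> I" for i y z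
  proof -
    have "\<beta> i * (k (p i) (y * z) - k (p i) y * \<phi> z) = \<beta> i * (\<mu> i y * k (p i) z)"
      using compare_coefficients(2)[OF ind bracketings i] by (simp add: algebra_simps)
    then show ?thesis using nz[OF i] by simp
  qed
  show "k j z = 0" if "j \<in> J" for j z
    using that k
    by (intro common_multiple_in_block_vanishes[of j "\<lambda>y. k j (y * z) - k j y * \<phi> z"]) blast+
qed

text \<open>Since \<open>f = h 1 * g + (\<Sum>j. hs j 1 * G j)\<close> with \<open>h 1 \<noteq> 0\<close>, replacing \<open>g\<close> by \<open>f\<close> is a change of
  basis: it preserves independence from the \<open>\<mu> i\<close>, and it turns the coefficient of \<open>G j\<close> into
  \<open>k j = hs j - hs j 1 * \<phi>\<close>. Once \<open>k j = 0\<close>, putting \<open>x = 1\<close> in the normal form makes \<open>f\<close> a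
  multiple of \<open>\<phi>\<close>.\<close>

theorem solution_form:
  assumes eq: "\<And>x y. f (x * y) = g x * h y + (\<Sum>j\<in>J. G j x * hs j y)"
    and f: "f \<noteq> (\<lambda>x. 0)" and ind: "independent_with g"
  shows "\<exists>\<chi> a b c. nonzero_multiplicative \<chi> \<and> (\<forall>i\<in>I. \<chi> \<noteq> \<mu> i) \<and> a \<noteq> 0 \<and> b \<noteq> 0 \<and>
    f = (\<lambda>x. a * b * \<chi> x) \<and> g = (\<lambda>x. b * \<chi> x - (\<Sum>k\<in>J. c k * G k x)) \<and>
    h = (\<lambda>x. a * \<chi> x) \<and> (\<forall>j\<in>J. hs j = (\<lambda>x. a * c j * \<chi> x))"
proof -
  define a \<phi> c b k where "a = h 1" and "\<phi> = (\<lambda>y. h y / a)" and "c = (\<lambda>j. hs j 1 / a)"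
    and "b = f 1 / a" and "k = (\<lambda>j y. hs j y - hs j 1 * \<phi> y)"
  have a: "a \<noteq> 0" unfolding a_def by (rule coefficient_at_one_nonzero[OF eq f ind])
  have f_eq: "f x = a * g x + (\<Sum>j\<in>J. G j x * hs j 1)" for x
    using eq[of x 1] by (simp add: a_def mult.commute)
  have normal: "f (x * y) = f x * \<phi> y + (\<Sum>j\<in>J. G j x * k j y)" for x y
  proof -
    have "f x * \<phi> y + (\<Sum>j\<in>J. G j x * k j y)
        = a * g x * \<phi> y + (\<Sum>j\<in>J. G j x * (hs j 1 * \<phi> y) + G j x * k j y)"
      by (simp add: f_eq distrib_right sum_distrib_right sum.distrib mult.assoc)
    also have "\<dots> = g x * h y + (\<Sum>j\<in>J. G j x * hs j y)"
      using a by (simp add: k_def \<phi>_def right_diff_distrib)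
    finally show ?thesis using eq by simp
  qed
  have ind_f: "independent_with f"
    unfolding independent_with_def
  proof (intro allI impI)
    fix s r assume zero: "\<forall>x. s * f x + (\<Sum>i\<in>I. r i * \<mu> i x) = 0"
    have "(s * a) * g x + (\<Sum>i\<in>I. (s * (\<beta> i * hs (p i) 1) + r i) * \<mu> i x)
        = 0 * g x + (\<Sum>i\<in>I. 0 * \<mu> i x)" for x
      using zero[rule_format, of x]
      by (simp add: f_eq block_combination algebra_simps sum.distrib sum_distrib_left)
    note coeffs = compare_coefficients[OF ind this]
    from coeffs(1) a have "s = 0" by simp
    with coeffs(2) show "s = 0 \<and> (\<forall>i\<in>I. r i = 0)" by simp
  qed
  note collapse = normal_form_collapses[OF normal ind_f]
  have f_form: "f x = f 1 * \<phi> x" for x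
    using normal[of 1 x] collapse(2) by simp
  then have f1: "f 1 \<noteq> 0" using f by (metis mult_zero_left ext)
  have g_form: "g x = b * \<phi> x - (\<Sum>k\<in>J. c k * G k x)" for x
  proof -
    have "(\<Sum>k\<in>J. c k * G k x) = (\<Sum>j\<in>J. G j x * hs j 1) / a"
      by (simp add: c_def sum_divide_distrib mult.commute)
    then show ?thesis using f_eq[of x] f_form[of x] a by (simp add: b_def field_simps)
  qed
  have "\<phi> 1 = 1" using a by (simp add: \<phi>_def a_def)
  then have "\<phi> \<noteq> (\<lambda>x. 0)" by auto
  with collapse(1) have "nonzero_multiplicative \<phi>" by (simp add: nonzero_multiplicative_def)
  moreover have "\<phi> \<noteq> \<mu> i" if i: "i \<in> I" for i
  proof
    assume "\<phi> = \<mu> i"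
    \<comment> \<open>\<open>f\<close> would be a multiple of \<open>\<mu> i\<close>, against independence.\<close>
    then have "1 * f x + (\<Sum>l\<in>I. (if l = i then - f 1 else 0) * \<mu> l x) = 0" for x
      using f_form[of x] i finite_I by (simp add: if_distrib[of "\<lambda>c. c * _"] cong: if_cong)
    then have "(1::'k) = 0"
      using ind_f[unfolded independent_with_def, THEN spec, THEN spec,
        of 1 "\<lambda>l. if l = i then - f 1 else 0"] by blast
    then show False by simp
  qed
  moreover have "hs j = (\<lambda>x. a * c j * \<phi> x)" if "j \<in> J" for j
  proof
    show "hs j x = a * c j * \<phi> x" for x
      using collapse(2)[OF that, of x] a by (simp add: k_def c_def)
  qed
  moreover have "f = (\<lambda>x. a * b * \<phi> x)"
    by (rule ext, subst f_form) (use a in \<open>simp add: b_def\<close>)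
  moreover have "h = (\<lambda>x. a * \<phi> x)"
    using a by (simp add: \<phi>_def)
  moreover have "b \<noteq> 0" using f1 a by (simp add: b_def)
  moreover have "g = (\<lambda>x. b * \<phi> x - (\<Sum>k\<in>J. c k * G k x))" using g_form by (rule ext)
  ultimately show ?thesis using a by blast
qed

end

section \<open>Consecutive intervals of indices\<close>

text \<open>Label each index by the first interval whose right end reaches it.\<close>

lemma consecutive_intervals_are_fibres:
  fixes lo hi :: "nat \<Rightarrow> nat"
  assumes "lo 1 = 1" and consec: "\<And>j. 1 \<le> j \<Longrightarrow> j \<le> n - 1 \<Longrightarrow> lo (j + 1) = hi j + 1"
    and last: "hi n = m" and ne: "\<And>j. j \<in> {1..n} \<Longrightarrow> lo j \<le> hi j" and n: "n \<ge> 1"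
  obtains p where "p ` {1..m} \<subseteq> {1..n}"
    and "\<And>j. j \<in> {1..n} \<Longrightarrow> {i\<in>{1..m}. p i = j} = {lo j..hi j}"
proof
  define p where "p = (\<lambda>i. LEAST j. 1 \<le> j \<and> i \<le> hi j)"
  have mono: "hi j < hi j'" if "1 \<le> j" "j < j'" "j' \<le> n" for j j'
    using that(2,3)
  proof (induction j' rule: less_induct)
    case (less j')
    then obtain l where l: "j' = Suc l" "j \<le> l" by (cases j') auto
    have "hi l < hi j'" using consec[of l] ne[of j'] l less.prems that(1) by auto
    then show ?case using less.IH[of l] l less.prems by (cases "j = l") auto
  qed
  have reach: "1 \<le> p i \<and> i \<le> hi (p i) \<and> p i \<le> n" if "i \<le> m" for i
    using that last n unfolding p_def
    by (metis (mono_tags, lifting) LeastI Least_le)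
  then show "p ` {1..m} \<subseteq> {1..n}" by auto
  show "{i\<in>{1..m}. p i = j} = {lo j..hi j}" if j: "j \<in> {1..n}" for j
  proof (intro equalityI subsetI)
    fix i assume "i \<in> {i\<in>{1..m}. p i = j}"
    then have i: "1 \<le> i" "i \<le> m" "p i = j" by auto
    have "lo j \<le> i"
    proof (cases "j = 1")
      case False
      then obtain l where l: "j = Suc l" "1 \<le> l" using j by (cases j) auto
      have "\<not> i \<le> hi l"
        using not_less_Least[of l "\<lambda>j. 1 \<le> j \<and> i \<le> hi j"] l i unfolding p_def by auto
      then show ?thesis using consec[of l] l j by auto
    qed (use i assms(1) in simp)
    then show "i \<in> {lo j..hi j}" using reach[of i] i by auto
  next
    fix i assume i: "i \<in> {lo j..hi j}"
    have below: "\<not> i \<le> hi l" if l: "1 \<le> l" "l < j" for l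
    proof -
      obtain q where q: "j = Suc q" "l \<le> q" using l by (cases j) auto
      have "hi l \<le> hi q" using mono[of l q] q l j by (cases "l = q") auto
      then show ?thesis using consec[of q] q l j i by auto
    qed
    have "p i = j"
      unfolding p_def using i j below by (intro Least_equality) (auto simp: not_less[symmetric])
    moreover have "i \<le> m" using i mono[of j n] j last by (cases "j = n") auto
    moreover have "1 \<le> i"
    proof (cases "j = 1")
      case False
      then have "\<not> i \<le> hi 1" using below[of 1] j by auto
      then show ?thesis by simp
    qed (use i assms(1) in auto)
    ultimately show "i \<in> {i\<in>{1..m}. p i = j}" by simp
  qed
qed

theorem proposition2p4:
  fixes n m :: nat
    and \<mu> :: "nat \<Rightarrow> 'm::monoid_mult \<Rightarrow> 'k::field"
    and \<beta> :: "nat \<Rightarrow> 'k"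
    and lo hi :: "nat \<Rightarrow> nat"
    and G :: "nat \<Rightarrow> 'm \<Rightarrow> 'k"
  assumes n: "n \<ge> 2"
    and mult: "\<And>i. i \<in> {1..m} \<Longrightarrow> nonzero_multiplicative (\<mu> i)"
    and dist: "inj_on \<mu> {1..m}"
    and nz: "\<And>i. i \<in> {1..m} \<Longrightarrow> \<beta> i \<noteq> 0"
    and first: "lo 1 = 1"
    and consec: "\<And>j. 1 \<le> j \<Longrightarrow> j \<le> n - 1 \<Longrightarrow> lo (j + 1) = hi j + 1"
    and last: "hi n = m"
    and two: "\<And>j. j \<in> {1..n} \<Longrightarrow> lo j + 1 \<le> hi j"
    and G: "\<And>j. j \<in> {1..n} \<Longrightarrow> G j = (\<lambda>x. \<Sum>i=lo j..hi j. \<beta> i * \<mu> i x)"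
  shows "(\<forall>(f :: 'm \<Rightarrow> 'k) g h (hs :: nat \<Rightarrow> 'm \<Rightarrow> 'k).
            (\<forall>x y. f (x * y) = g x * h y + (\<Sum>j=1..n. G j x * hs j y)) \<longrightarrow>
            f \<noteq> (\<lambda>x. 0) \<longrightarrow>
            independent_family {0..m} (\<lambda>i. if i = 0 then g else \<mu> i) \<longrightarrow>
            (\<exists>\<chi> a b (c :: nat \<Rightarrow> 'k).
               nonzero_multiplicative \<chi> \<and> (\<forall>i\<in>{1..m}. \<chi> \<noteq> \<mu> i) \<and> a \<noteq> 0 \<and> b \<noteq> 0 \<and>
               f = (\<lambda>x. a * b * \<chi> x) \<and>
               g = (\<lambda>x. b * \<chi> x - (\<Sum>k=1..n. c k * G k x)) \<and>
               h = (\<lambda>x. a * \<chi> x) \<and>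
               (\<forall>j\<in>{1..n}. hs j = (\<lambda>x. a * c j * \<chi> x))))
       \<and> (\<forall>\<chi> a b (c :: nat \<Rightarrow> 'k) (f :: 'm \<Rightarrow> 'k) g h (hs :: nat \<Rightarrow> 'm \<Rightarrow> 'k).
            nonzero_multiplicative \<chi> \<longrightarrow> (\<forall>i\<in>{1..m}. \<chi> \<noteq> \<mu> i) \<longrightarrow> a \<noteq> 0 \<longrightarrow> b \<noteq> 0 \<longrightarrow>
            f = (\<lambda>x. a * b * \<chi> x) \<longrightarrow>
            g = (\<lambda>x. b * \<chi> x - (\<Sum>k=1..n. c k * G k x)) \<longrightarrow>
            h = (\<lambda>x. a * \<chi> x) \<longrightarrow>
            (\<forall>j\<in>{1..n}. hs j = (\<lambda>x. a * c j * \<chi> x)) \<longrightarrow>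
            (\<forall>x y. f (x * y) = g x * h y + (\<Sum>j=1..n. G j x * hs j y)))"
proof (intro conjI allI impI)
  obtain p where p_into: "p ` {1..m} \<subseteq> {1..n}"
    and fibre: "\<And>j. j \<in> {1..n} \<Longrightarrow> {i\<in>{1..m}. p i = j} = {lo j..hi j}"
    using consecutive_intervals_are_fibres[of lo n hi m] first consec last two n
    by (smt (verit) add_leD1 le_trans one_le_numeral)
  interpret multiplicative_blocks "{1..m}" "{1..n}" p \<mu> \<beta> G
  proof
    show "finite {1..m}" "finite {1..n}" by simp_all
    show "p ` {1..m} \<subseteq> {1..n}" by (rule p_into)
    show "multiplicative (\<mu> i)" "\<beta> i \<noteq> 0" if "i \<in> {1..m}" for i
      using mult[OF that] nz[OF that]
      by (auto simp: nonzero_multiplicative_def)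
    fix j assume j: "j \<in> {1..n}"
    show "G j = (\<lambda>x. \<Sum>i\<in>{i\<in>{1..m}. p i = j}. \<beta> i * \<mu> i x)"
      unfolding fibre[OF j] by (rule G[OF j])
    have "lo j \<in> {i\<in>{1..m}. p i = j}" "lo j + 1 \<in> {i\<in>{1..m}. p i = j}"
      using two[OF j] unfolding fibre[OF j] by auto
    then show "\<exists>i\<in>{1..m}. \<exists>i'\<in>{1..m}. p i = j \<and> p i' = j \<and> \<mu> i \<noteq> \<mu> i'"
      using dist by (intro bexI[of _ "lo j"] bexI[of _ "lo j + 1"]) (auto dest: inj_onD)
  qed
  fix f g h :: "'m \<Rightarrow> 'k" and hs :: "nat \<Rightarrow> 'm \<Rightarrow> 'k"
  assume eq: "\<forall>x y. f (x * y) = g x * h y + (\<Sum>j=1..n. G j x * hs j y)"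
    and f: "f \<noteq> (\<lambda>x. 0)"
    and ind: "independent_family {0..m} (\<lambda>i. if i = 0 then g else \<mu> i)"
  have "independent_with g"
    unfolding independent_with_def
  proof (intro allI impI)
    fix s r assume zero: "\<forall>x. s * g x + (\<Sum>i=1..m. r i * \<mu> i x) = 0"
    define c where "c = (\<lambda>i. if i = 0 then s else r i)"
    have "(\<Sum>i=0..m. c i * (if i = 0 then g else \<mu> i) x) = 0" for x
      using zero by (simp add: sum.atLeast_Suc_atMost c_def)
    then have c: "\<forall>i\<in>{0..m}. c i = 0"
      using ind by (simp add: independent_family_iff)
    have "s = 0" using bspec[OF c, of 0] by (simp add: c_def)
    moreover have "r i = 0" if "i \<in> {1..m}" for i
      using bspec[OF c, of i] that by (simp add: c_def)
    ultimately show "s = 0 \<and> (\<forall>i\<in>{1..m}. r i = 0)" by blast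
  qed
  with eq f show "\<exists>\<chi> a b (c :: nat \<Rightarrow> 'k).
       nonzero_multiplicative \<chi> \<and> (\<forall>i\<in>{1..m}. \<chi> \<noteq> \<mu> i) \<and> a \<noteq> 0 \<and> b \<noteq> 0 \<and>
       f = (\<lambda>x. a * b * \<chi> x) \<and>
       g = (\<lambda>x. b * \<chi> x - (\<Sum>k=1..n. c k * G k x)) \<and>
       h = (\<lambda>x. a * \<chi> x) \<and>
       (\<forall>j\<in>{1..n}. hs j = (\<lambda>x. a * c j * \<chi> x))"
    by (intro solution_form) auto
next
  fix \<chi> :: "'m \<Rightarrow> 'k" and a b and c :: "nat \<Rightarrow> 'k" and f g h :: "'m \<Rightarrow> 'k"
    and hs :: "nat \<Rightarrow> 'm \<Rightarrow> 'k" and x y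
  assume "nonzero_multiplicative \<chi>"
    and f: "f = (\<lambda>x. a * b * \<chi> x)"
    and g: "g = (\<lambda>x. b * \<chi> x - (\<Sum>k=1..n. c k * G k x))"
    and h: "h = (\<lambda>x. a * \<chi> x)"
    and hs: "\<forall>j\<in>{1..n}. hs j = (\<lambda>x. a * c j * \<chi> x)"
  then have \<chi>: "\<chi> (x * y) = \<chi> x * \<chi> y"
    by (simp add: nonzero_multiplicative_def multiplicative_def)
  have "(\<Sum>j=1..n. G j x * hs j y) = (\<Sum>k=1..n. c k * G k x) * (a * \<chi> y)"
    unfolding sum_distrib_right using hs by (intro sum.cong) auto
  then show "f (x * y) = g x * h y + (\<Sum>j=1..n. G j x * hs j y)"
    unfolding f g h \<chi> by (simp add: left_diff_distrib)
qed

end
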